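(* Let $\Omega=\{\mathbf a_1,\dots,\mathbf a_k\}\subseteq\mathbb F^n$ be a finite set of $k\ge1$ distinct points. (Left version.) The following conditions are equivalent: 1) $\Omega$ is left P-independent; 2) there exist $F_1,\dots,F_k\in\mathcal R$ with $\deg(F_i)<k$ for all $i$ such that the map $\psi:\langle F_1,\dots,F_k\rangle\to\mathbb F^k$, $F\mapsto(F(\mathbf a_1),\dots,F(\mathbf a_k))$, is an isomorphism of left $\mathbb F$-modules, where $\langle F_1,\dots,F_k\rangle$ is the left $\mathbb F$-submodule of $\mathcal R$ generated by the $F_j$; 3) for all $b_1,\dots,b_k\in\mathbb F$ there exists $F\in\mathcal R$ with $\deg(F)<k$ and $F(\mathbf a_j)=b_j$ for $j=1,\dots,k$. (Right version.) Assume that $\varphi$ is an isomorphism of additive groups. The following conditions are equivalent: 1) $\Omega$ is right P-independent; 2) there exist $F_1,\dots,F_k\in\mathcal R$ with $\deg(F_i)<k$ for all $i$ such that the map $\psi_L:\langle F_1,\dots,F_k\rangle_L\to\mathbb F^k$, $F\mapsto(F_L(\mathbf a_1),\dots,F_L(\mathbf a_k))$, is an isomorphism of right $\mathbb F$-modules, where $\langle F_1,\dots,F_k\rangle_L$ is the right $\mathbb F$-submodule of $\mathcal R$ generated by the $F_j$; 3) for all $b_1,\dots,b_k\in\mathbb F$ there exists $F\in\mathcal R$ with $\deg(F)<k$ and $F_L(\mathbf a_j)=b_j$ for $j=1,\dots,k$.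
   Context: $\mathbb F$ is a division ring, $n\ge1$, $\sigma=(\sigma_{i,j}):\mathbb F\to\mathbb F^{n\times n}$ is a (unital) ring homomorphism and $\delta={}^t(\delta_1,\dots,\delta_n):\mathbb F\to\mathbb F^{n\times1}$ is a $\sigma$-vector derivation, i.e. additive with $\delta(ab)=\sigma(a)\delta(b)+\delta(a)b$. $\mathcal M$ is the free monoid on $x_1,\dots,x_n$, with empty word identified with $1$. $\mathcal R=\mathbb F[\mathbf x;\sigma,\delta]$ is the free left $\mathbb F$-module with basis $\mathcal M$, with the ring multiplication that concatenates monomials and satisfies $x_i a=\sum_j\sigma_{i,j}(a)x_j+\delta_i(a)$ for $a\in\mathbb F$. $\deg F$ is the maximal length of a monomial with nonzero coefficient in $F$, and $\deg 0=-\infty$. Define $\varphi:\mathbb F^n\to\mathbb F^n$ by $\varphi(\gamma_1,\dots,\gamma_n)=\big(\sum_j\sigma_{j,1}(\gamma_j),\dots,\sum_j\sigma_{j,n}(\gamma_j)\big)$. Right evaluation: for $\mathbf a=(a_1,\dots,a_n)\in\mathbb F^n$ every $F\in\mathcal R$ is uniquely $F=\sum_iG_i(x_i-a_i)+F(\mathbf a)$ with $G_i\in\mathcal R$, $F(\mathbf a)\in\mathbb F$. Left evaluation (when $\varphi$ is bijective): every $F$ is uniquely $F=\sum_i(x_i-a_i)G_{i,L}+F_L(\mathbf a)$ with $G_{i,L}\in\mathcal R$, $F_L(\mathbf a)\in\mathbb F$. For $S\subseteq\mathbb F^n$ let $I(S)=\{F\in\mathcal R: F(\mathbf a)=0\ \forall\mathbf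 a\in S\}$ and $I_L(S)=\{F\in\mathcal R:F_L(\mathbf a)=0\ \forall\mathbf a\in S\}$. A finite set $\Omega=\{\mathbf a_1,\dots,\mathbf a_k\}$ is left P-independent if $I(\Omega\setminus\{\mathbf a_j\})\supsetneq I(\Omega)$ for every $j$, and right P-independent if $I_L(\Omega\setminus\{\mathbf a_j\})\supsetneq I_L(\Omega)$ for every $j$. *)

theory Defs
  imports "HOL-Analysis.Analysis" "HOL-Library.Poly_Mapping"
begin

section \<open>The free multivariate skew polynomial ring\<close>

definition matrix_ring_hom :: "('a::division_ring \<Rightarrow> 'a ^ 'n ^ 'n) \<Rightarrow> bool" where
  "matrix_ring_hom \<sigma> \<longleftrightarrow>
     Modules.additive \<sigma> \<and> (\<forall>a b. \<sigma> (a * b) = \<sigma> a ** \<sigma> b) \<and> \<sigma> 1 = mat 1"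

definition vector_derivation ::
    "('a::division_ring \<Rightarrow> 'a ^ 'n ^ 'n) \<Rightarrow> ('a \<Rightarrow> 'a ^ 'n) \<Rightarrow> bool" where
  "vector_derivation \<sigma> \<delta> \<longleftrightarrow>
     Modules.additive \<delta> \<and> (\<forall>a b. \<delta> (a * b) = \<sigma> a *v \<delta> b + (\<chi> i. \<delta> a $ i * b))"

text \<open>Words over the index type are the monomials, the empty word being \<open>1\<close>; an element of the
  free left module on them is a finitely supported family of (left) coefficients. The
  multiplication depends on \<open>\<sigma>\<close> and \<open>\<delta>\<close>, so it is not an instance of the class \<open>times\<close>.\<close>

type_synonym ('n, 'a) skew_poly = "'n list \<Rightarrow>\<^sub>0 'a"

definition skew_const :: "'a::zero \<Rightarrow> ('n, 'a) skew_poly" where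
  "skew_const c = Poly_Mapping.single [] c"

definition skew_var :: "'n \<Rightarrow> ('n, 'a::zero_neq_one) skew_poly" where
  "skew_var i = Poly_Mapping.single [i] 1"

definition lscale :: "'a::semiring_0 \<Rightarrow> ('n, 'a) skew_poly \<Rightarrow> ('n, 'a) skew_poly" where
  "lscale c F = Poly_Mapping.map (\<lambda>b. c * b) F"

text \<open>Left multiplication by the variable \<open>x\<^sub>i\<close>, which sends \<open>b w\<close> to
  \<open>\<Sum>\<^sub>j \<sigma>\<^sub>i\<^sub>j(b) x\<^sub>j w + \<delta>\<^sub>i(b) w\<close>.\<close>

definition var_mult :: "('a::division_ring \<Rightarrow> 'a ^ 'n ^ 'n) \<Rightarrow> ('a \<Rightarrow> 'a ^ 'n) \<Rightarrow>
    'n::finite \<Rightarrow> ('n, 'a) skew_poly \<Rightarrow> ('n, 'a) skew_poly" where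
  "var_mult \<sigma> \<delta> i G =
     (\<Sum>w\<in>Poly_Mapping.keys G.
        (\<Sum>j\<in>UNIV. Poly_Mapping.single (j # w) (\<sigma> (Poly_Mapping.lookup G w) $ i $ j))
        + Poly_Mapping.single w (\<delta> (Poly_Mapping.lookup G w) $ i))"

definition skew_mult :: "('a::division_ring \<Rightarrow> 'a ^ 'n ^ 'n) \<Rightarrow> ('a \<Rightarrow> 'a ^ 'n) \<Rightarrow>
    ('n::finite, 'a) skew_poly \<Rightarrow> ('n, 'a) skew_poly \<Rightarrow> ('n, 'a) skew_poly" where
  "skew_mult \<sigma> \<delta> F G =
     (\<Sum>w\<in>Poly_Mapping.keys F. lscale (Poly_Mapping.lookup F w) (foldr (var_mult \<sigma> \<delta>) w G))"

text \<open>The supremum of the empty set in \<^typ>\<open>ereal\<close> is \<open>-\<infinity>\<close>, hence so is the degree of \<open>0\<close>.\<close>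

definition skew_degree :: "('n, 'a::zero) skew_poly \<Rightarrow> ereal" where
  "skew_degree F = (SUP w\<in>Poly_Mapping.keys F. ereal (real (length w)))"

section \<open>Evaluation and P-independence\<close>

definition phi_map :: "('a::division_ring \<Rightarrow> 'a ^ 'n ^ 'n) \<Rightarrow> 'a ^ 'n::finite \<Rightarrow> 'a ^ 'n" where
  "phi_map \<sigma> \<gamma> = (\<chi> i. \<Sum>j\<in>UNIV. \<sigma> (\<gamma> $ j) $ j $ i)"

definition additive_group_iso :: "('a::ab_group_add \<Rightarrow> 'b::ab_group_add) \<Rightarrow> bool" where
  "additive_group_iso f \<longleftrightarrow> Modules.additive f \<and> bij f"

definition right_eval :: "('a::division_ring \<Rightarrow> 'a ^ 'n ^ 'n) \<Rightarrow> ('a \<Rightarrow> 'a ^ 'n) \<Rightarrow>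
    ('n::finite, 'a) skew_poly \<Rightarrow> 'a ^ 'n \<Rightarrow> 'a" where
  "right_eval \<sigma> \<delta> F a =
     (THE c. \<exists>G. F = (\<Sum>i\<in>UNIV. skew_mult \<sigma> \<delta> (G i) (skew_var i - skew_const (a $ i)))
                     + skew_const c)"

text \<open>Meaningful only when \<^term>\<open>phi_map \<sigma>\<close> is bijective.\<close>

definition left_eval :: "('a::division_ring \<Rightarrow> 'a ^ 'n ^ 'n) \<Rightarrow> ('a \<Rightarrow> 'a ^ 'n) \<Rightarrow>
    ('n::finite, 'a) skew_poly \<Rightarrow> 'a ^ 'n \<Rightarrow> 'a" where
  "left_eval \<sigma> \<delta> F a =
     (THE c. \<exists>G. F = (\<Sum>i\<in>UNIV. skew_mult \<sigma> \<delta> (skew_var i - skew_const (a $ i)) (G i))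
                     + skew_const c)"

definition vanishing_ideal :: "(('n, 'a) skew_poly \<Rightarrow> 'a ^ 'n \<Rightarrow> 'a::zero) \<Rightarrow>
    ('a ^ 'n) set \<Rightarrow> ('n, 'a) skew_poly set" where
  "vanishing_ideal ev S = {F. \<forall>a\<in>S. ev F a = 0}"

definition left_P_independent :: "('a::division_ring \<Rightarrow> 'a ^ 'n ^ 'n) \<Rightarrow> ('a \<Rightarrow> 'a ^ 'n) \<Rightarrow>
    ('a ^ 'n::finite) set \<Rightarrow> bool" where
  "left_P_independent \<sigma> \<delta> \<Omega> \<longleftrightarrow> finite \<Omega> \<and>
     (\<forall>a\<in>\<Omega>. vanishing_ideal (right_eval \<sigma> \<delta>) \<Omega> \<subset> vanishing_ideal (right_eval \<sigma> \<delta>) (\<Omega> - {a}))"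

definition right_P_independent :: "('a::division_ring \<Rightarrow> 'a ^ 'n ^ 'n) \<Rightarrow> ('a \<Rightarrow> 'a ^ 'n) \<Rightarrow>
    ('a ^ 'n::finite) set \<Rightarrow> bool" where
  "right_P_independent \<sigma> \<delta> \<Omega> \<longleftrightarrow> finite \<Omega> \<and>
     (\<forall>a\<in>\<Omega>. vanishing_ideal (left_eval \<sigma> \<delta>) \<Omega> \<subset> vanishing_ideal (left_eval \<sigma> \<delta>) (\<Omega> - {a}))"

section \<open>Modules over a division ring\<close>

text \<open>The library locales for modules need commutative scalars. A one-sided module is given here
  by its scalar action, written with the scalar first also for right modules.\<close>

definition submodule :: "('a::division_ring \<Rightarrow> 'm \<Rightarrow> 'm) \<Rightarrow> 'm::ab_group_add set \<Rightarrow> bool" where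
  "submodule s N \<longleftrightarrow> 0 \<in> N \<and> (\<forall>x\<in>N. \<forall>y\<in>N. x + y \<in> N) \<and> (\<forall>c. \<forall>x\<in>N. s c x \<in> N)"

definition module_isomorphism_on :: "('a::division_ring \<Rightarrow> 'm \<Rightarrow> 'm) \<Rightarrow> ('a \<Rightarrow> 'l \<Rightarrow> 'l) \<Rightarrow>
    'm::ab_group_add set \<Rightarrow> 'l::ab_group_add set \<Rightarrow> ('m \<Rightarrow> 'l) \<Rightarrow> bool" where
  "module_isomorphism_on s t N L f \<longleftrightarrow> bij_betw f N L \<and>
     (\<forall>x\<in>N. \<forall>y\<in>N. f (x + y) = f x + f y) \<and> (\<forall>c. \<forall>x\<in>N. f (s c x) = t c (f x))"

definition rscale :: "('a::division_ring \<Rightarrow> 'a ^ 'n ^ 'n) \<Rightarrow> ('a \<Rightarrow> 'a ^ 'n) \<Rightarrow>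
    'a \<Rightarrow> ('n::finite, 'a) skew_poly \<Rightarrow> ('n, 'a) skew_poly" where
  "rscale \<sigma> \<delta> c F = skew_mult \<sigma> \<delta> F (skew_const c)"

definition vec_rscale :: "'a::times \<Rightarrow> 'a ^ 'k \<Rightarrow> 'a ^ 'k" where
  "vec_rscale c v = (\<chi> j. v $ j * c)"

section \<open>The multiplication is the intended ring structure\<close>

lemma lookup_lscale [simp]:
  "Poly_Mapping.lookup (lscale c F) w = c * Poly_Mapping.lookup F w"
  by (simp add: lscale_def Poly_Mapping.map.rep_eq when_def)

lemma lscale_simps [simp]:
  "lscale c 0 = 0" "lscale 0 F = 0" "lscale 1 (G :: ('n, 'a::semiring_1) skew_poly) = G"
  "lscale c (Poly_Mapping.single w b) = Poly_Mapping.single w (c * b)"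
  "lscale c (F + F') = lscale c F + lscale c F'"
  "lscale (c + d) F = lscale c F + lscale d F"
  "lscale c (lscale d F) = lscale (c * d) F"
  by (auto intro!: poly_mapping_eqI simp: lookup_add lookup_single when_def algebra_simps)

lemma lscale_sum: "lscale c (sum f A) = (\<Sum>x\<in>A. lscale c (f x))"
  by (induction A rule: infinite_finite_induct) auto

lemma lscale_sum_left: "lscale (sum f A) F = (\<Sum>x\<in>A. lscale (f x) F)"
  by (induction A rule: infinite_finite_induct) auto

lemma sum_single_keys:
  "(\<Sum>w\<in>Poly_Mapping.keys F. Poly_Mapping.single w (Poly_Mapping.lookup F w)) = F"
  by (rule poly_mapping_eqI)
     (auto simp: lookup_sum lookup_single when_def in_keys_iff sum.delta)

lemma skew_poly_induct [case_names zero add single]: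
  fixes F :: "('n, 'a::ab_group_add) skew_poly"
  assumes "P 0" "\<And>F G. P F \<Longrightarrow> P G \<Longrightarrow> P (F + G)" "\<And>w c. P (Poly_Mapping.single w c)"
  shows "P F"
proof -
  have "P (\<Sum>w\<in>A. Poly_Mapping.single w (Poly_Mapping.lookup F w))" for A
    by (induction A rule: infinite_finite_induct) (auto intro: assms)
  from this[of "Poly_Mapping.keys F"] show ?thesis by (simp add: sum_single_keys)
qed

lemma sum_keys_additive:
  fixes f :: "'b \<Rightarrow> 'a::ab_group_add \<Rightarrow> 'c::comm_monoid_add"
  assumes "\<And>w. f w 0 = 0" "\<And>w a b. f w (a + b) = f w a + f w b"
  shows "(\<Sum>w\<in>Poly_Mapping.keys (F + G). f w (Poly_Mapping.lookup (F + G) w)) =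
    (\<Sum>w\<in>Poly_Mapping.keys F. f w (Poly_Mapping.lookup F w)) +
    (\<Sum>w\<in>Poly_Mapping.keys G. f w (Poly_Mapping.lookup G w))"
proof -
  let ?K = "Poly_Mapping.keys F \<union> Poly_Mapping.keys G"
  have *: "(\<Sum>w\<in>Poly_Mapping.keys H. f w (Poly_Mapping.lookup H w)) =
      (\<Sum>w\<in>?K. f w (Poly_Mapping.lookup H w))" if "Poly_Mapping.keys H \<subseteq> ?K" for H
    by (rule sum.mono_neutral_left) (use that assms in \<open>auto simp: in_keys_iff\<close>)
  show ?thesis
    using *[of F] *[of G] *[OF Poly_Mapping.keys_add]
    by (simp add: lookup_add assms sum.distrib)
qed

context
  fixes \<sigma> :: "'a::division_ring \<Rightarrow> 'a ^ 'n::finite ^ 'n" and \<delta> :: "'a \<Rightarrow> 'a ^ 'n"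
  assumes hom: "matrix_ring_hom \<sigma>" and der: "vector_derivation \<sigma> \<delta>"
begin

private lemma add_rules:
  "\<sigma> (a + b) = \<sigma> a + \<sigma> b" "\<sigma> 0 = 0" "\<delta> (a + b) = \<delta> a + \<delta> b" "\<delta> 0 = 0"
  using hom der Modules.additive.add Modules.additive.zero
  unfolding matrix_ring_hom_def vector_derivation_def by blast+

private lemma mult_rules:
  "\<sigma> (a * b) $ i $ j = (\<Sum>k\<in>UNIV. \<sigma> a $ i $ k * \<sigma> b $ k $ j)"
  "\<delta> (a * b) $ i = (\<Sum>k\<in>UNIV. \<sigma> a $ i $ k * \<delta> b $ k) + \<delta> a $ i * b"
  using hom der unfolding matrix_ring_hom_def vector_derivation_def
  by (simp_all add: matrix_matrix_mult_def matrix_vector_mult_def)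

private lemma one_rules: "\<sigma> 1 = mat 1" "\<delta> 1 = 0"
proof -
  show s: "\<sigma> 1 = mat 1" using hom by (simp add: matrix_ring_hom_def)
  have "\<delta> (1 * 1) = \<sigma> 1 *v \<delta> 1 + (\<chi> i. \<delta> 1 $ i * 1)"
    using der unfolding vector_derivation_def by blast
  then show "\<delta> 1 = 0" by (simp add: s vec_eq_iff)
qed

private lemma var_mult_zero [simp]: "var_mult \<sigma> \<delta> i 0 = 0"
  by (simp add: var_mult_def)

private lemma var_mult_add: "var_mult \<sigma> \<delta> i (F + G) = var_mult \<sigma> \<delta> i F + var_mult \<sigma> \<delta> i G"
  unfolding var_mult_def
  by (rule sum_keys_additive) (simp_all add: add_rules single_add sum.distrib)

private lemma var_mult_sum: "var_mult \<sigma> \<delta> i (sum f A) = (\<Sum>x\<in>A. var_mult \<sigma> \<delta> i (f x))"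
  by (induction A rule: infinite_finite_induct) (auto simp: var_mult_add)

private lemma var_mult_single:
  "var_mult \<sigma> \<delta> i (Poly_Mapping.single w c) =
     (\<Sum>j\<in>UNIV. Poly_Mapping.single (j # w) (\<sigma> c $ i $ j)) + Poly_Mapping.single w (\<delta> c $ i)"
  by (cases "c = 0") (simp_all add: var_mult_def add_rules)

private lemma single_sum: "Poly_Mapping.single w (sum f A) = (\<Sum>x\<in>A. Poly_Mapping.single w (f x))"
  for f :: "'x \<Rightarrow> 'y::ab_group_add"
  by (induction A rule: infinite_finite_induct) (auto simp: single_add)

private lemma var_mult_lscale:
  "var_mult \<sigma> \<delta> i (lscale c F) =
     (\<Sum>j\<in>UNIV. lscale (\<sigma> c $ i $ j) (var_mult \<sigma> \<delta> j F)) + lscale (\<delta> c $ i) F"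
proof (induction F rule: skew_poly_induct)
  case (single w d)
  have "(\<Sum>j\<in>UNIV. \<Sum>k\<in>UNIV. Poly_Mapping.single (j # w) (\<sigma> c $ i $ k * \<sigma> d $ k $ j)) =
    (\<Sum>k\<in>UNIV. \<Sum>j\<in>UNIV. Poly_Mapping.single (j # w) (\<sigma> c $ i $ k * \<sigma> d $ k $ j))"
    by (rule sum.swap)
  then show ?case
    by (simp add: var_mult_single mult_rules single_sum single_add lscale_sum sum.distrib add.assoc)
qed (simp_all add: var_mult_add sum.distrib algebra_simps)

private lemma word_mult_add:
  "foldr (var_mult \<sigma> \<delta>) w (F + G) = foldr (var_mult \<sigma> \<delta>) w F + foldr (var_mult \<sigma> \<delta>) w G"
  by (induction w) (simp_all add: var_mult_add)

lemma skew_mult_zero: "skew_mult \<sigma> \<delta> 0 G = 0" "skew_mult \<sigma> \<delta> F 0 = 0"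
proof -
  have "foldr (var_mult \<sigma> \<delta>) w 0 = 0" for w by (induction w) simp_all
  then show "skew_mult \<sigma> \<delta> 0 G = 0" "skew_mult \<sigma> \<delta> F 0 = 0" by (simp_all add: skew_mult_def)
qed

lemma skew_mult_single:
  "skew_mult \<sigma> \<delta> (Poly_Mapping.single w c) G = lscale c (foldr (var_mult \<sigma> \<delta>) w G)"
  by (simp add: skew_mult_def)

lemma skew_mult_distrib:
  "skew_mult \<sigma> \<delta> (F + F') G = skew_mult \<sigma> \<delta> F G + skew_mult \<sigma> \<delta> F' G"
  "skew_mult \<sigma> \<delta> F (G + G') = skew_mult \<sigma> \<delta> F G + skew_mult \<sigma> \<delta> F G'"
proof -
  show "skew_mult \<sigma> \<delta> (F + F') G = skew_mult \<sigma> \<delta> F G + skew_mult \<sigma> \<delta> F' G"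
    unfolding skew_mult_def by (rule sum_keys_additive) simp_all
  show "skew_mult \<sigma> \<delta> F (G + G') = skew_mult \<sigma> \<delta> F G + skew_mult \<sigma> \<delta> F G'"
    by (simp add: skew_mult_def word_mult_add sum.distrib)
qed

private lemma skew_mult_sum_left:
  "skew_mult \<sigma> \<delta> (sum f A) G = (\<Sum>x\<in>A. skew_mult \<sigma> \<delta> (f x) G)"
  by (induction A rule: infinite_finite_induct) (auto simp: skew_mult_zero skew_mult_distrib)

private lemma skew_mult_lscale: "skew_mult \<sigma> \<delta> (lscale c F) G = lscale c (skew_mult \<sigma> \<delta> F G)"
  by (induction F rule: skew_poly_induct)
     (simp_all add: skew_mult_zero skew_mult_distrib skew_mult_single)

private lemma skew_mult_var_mult:
  "skew_mult \<sigma> \<delta> (var_mult \<sigma> \<delta> i F) G = var_mult \<sigma> \<delta> i (skew_mult \<sigma> \<delta> F G)"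
  by (induction F rule: skew_poly_induct)
     (simp_all add: skew_mult_zero skew_mult_distrib skew_mult_sum_left skew_mult_single
        var_mult_add var_mult_single var_mult_lscale)

lemma skew_mult_assoc:
  "skew_mult \<sigma> \<delta> (skew_mult \<sigma> \<delta> F G) H = skew_mult \<sigma> \<delta> F (skew_mult \<sigma> \<delta> G H)"
proof (induction F rule: skew_poly_induct)
  case (single w c)
  have "skew_mult \<sigma> \<delta> (foldr (var_mult \<sigma> \<delta>) w G) H = foldr (var_mult \<sigma> \<delta>) w (skew_mult \<sigma> \<delta> G H)"
    by (induction w) (simp_all add: skew_mult_var_mult)
  then show ?case by (simp add: skew_mult_single skew_mult_lscale)
qed (simp_all add: skew_mult_zero skew_mult_distrib)

private lemma word_mult_word:
  "foldr (var_mult \<sigma> \<delta>) u (Poly_Mapping.single v 1) = Poly_Mapping.single (u @ v) 1"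
proof (induction u)
  case (Cons i u)
  have "(\<Sum>j\<in>UNIV. Poly_Mapping.single (j # u @ v) (mat 1 $ i $ j)) =
      (\<Sum>j\<in>UNIV. if i = j then Poly_Mapping.single (j # u @ v) (1 :: 'a) else 0)"
    by (rule sum.cong) (auto simp: mat_def)
  with Cons show ?case by (simp add: var_mult_single one_rules)
qed simp

lemma skew_mult_monomials:
  "skew_mult \<sigma> \<delta> (Poly_Mapping.single u 1) (Poly_Mapping.single v 1) =
     Poly_Mapping.single (u @ v) 1"
  by (simp add: skew_mult_single word_mult_word)

lemma skew_mult_const: "skew_mult \<sigma> \<delta> (skew_const c) F = lscale c F"
  by (simp add: skew_const_def skew_mult_single)

lemma skew_mult_one: "skew_mult \<sigma> \<delta> (skew_const 1) F = F" "skew_mult \<sigma> \<delta> F (skew_const 1) = F"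
proof -
  show "skew_mult \<sigma> \<delta> (skew_const 1) F = F" by (simp add: skew_mult_const)
  show "skew_mult \<sigma> \<delta> F (skew_const 1) = F"
    by (induction F rule: skew_poly_induct)
       (simp_all add: skew_mult_zero skew_mult_distrib skew_mult_single skew_const_def
          word_mult_word)
qed

lemma skew_var_mult_const:
  "skew_mult \<sigma> \<delta> (skew_var i) (skew_const c) =
     (\<Sum>j\<in>UNIV. skew_mult \<sigma> \<delta> (skew_const (\<sigma> c $ i $ j)) (skew_var j)) + skew_const (\<delta> c $ i)"
  unfolding skew_mult_const
  by (simp add: skew_var_def skew_const_def skew_mult_single var_mult_single)

end

lemma skew_degree_less_iff:
  assumes "k \<ge> 1"
  shows "skew_degree F < ereal (real k) \<longleftrightarrow> (\<forall>w\<in>Poly_Mapping.keys F. length w < k)"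
  using assms
  by (cases "F = 0")
     (auto simp: skew_degree_def finite_Sup_less_iff bot_ereal_def)

end

theory Submission
  imports Defs
begin

text \<open>Interpolation with no bound on the degree is easy: P-independence says that each point can be
  separated from the others by a polynomial, and multiples of the separating polynomials, combined,
  take any prescribed values. What needs an argument is the bound on the degree. Let \<open>V\<^sub>d\<close> be the
  set of value vectors in \<open>\<bbbF>\<^sup>k\<close> of the polynomials of degree less than \<open>d\<close>. The \<open>V\<^sub>d\<close> form an
  ascending chain of submodules of \<open>\<bbbF>\<^sup>k\<close>, so at most \<open>k\<close> of its steps are strict.
  Moreover, the chain is constant from the first step that is not strict. The reason is that the
  values of \<open>x\<^sub>i F\<close> under right evaluation, and those of \<open>F x\<^sub>i\<close> under left evaluation, depend only
  on the values of \<open>F\<close>: write \<open>F = \<Sum>\<^sub>j G\<^sub>j (x\<^sub>j - a\<^sub>j) + F(a)\<close> and multiply by \<open>x\<^sub>i\<close> from the left,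
  and symmetrically. So if a word \<open>w\<close> has the same values as a polynomial of degree less than \<open>d\<close>,
  then \<open>x\<^sub>i w\<close> has the same values as one of degree less than \<open>d + 1\<close>, and \<open>V\<^sub>d\<^sub>+\<^sub>1 = V\<^sub>d\<close> lowers the
  degree again. Hence \<open>V\<^sub>k\<close> contains the values of all polynomials.

  Submodules of \<open>\<bbbF>\<^sup>k\<close> are compared through their pivot positions, as in Gaussian elimination, in
  place of a dimension theory for one-sided modules. The argument is carried out once, in the
  locale \<open>filtered_evaluation\<close>, for left and right scalars together.

  To verify the locale assumptions, both evaluations are computed by explicit recursions on words
  (\<open>right_val\<close> and \<open>left_val\<close>). Each recursion vanishes on the multiples of the \<open>x\<^sub>i - a\<^sub>i\<close>, which
  makes the remainder unique, and the remainder exists by induction on words. For left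
  evaluation the bijectivity of \<open>\<phi>\<close> is what allows a term \<open>c x\<^sub>k w\<close> to be written as
  \<open>\<Sum>\<^sub>j x\<^sub>j \<gamma>\<^sub>j w\<close> plus a multiple of \<open>w\<close>, with the variables to the left of the coefficients, ready
  for division.\<close>

section \<open>Chains of one-sided subspaces\<close>

text \<open>Left and right modules over a division ring are treated together: the parameter \<open>t\<close> is one of the
  two actions of the ring on itself, with the scalar written first.\<close>

definition one_sided :: "('a::division_ring \<Rightarrow> 'a \<Rightarrow> 'a) \<Rightarrow> bool" where
  "one_sided t \<longleftrightarrow> t = (\<lambda>c x. c * x) \<or> t = (\<lambda>c x. x * c)"

definition coordwise :: "('a \<Rightarrow> 'a \<Rightarrow> 'a) \<Rightarrow> 'a \<Rightarrow> 'a ^ 'k \<Rightarrow> 'a ^ 'k" where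
  "coordwise t c v = (\<chi> j. t c (v $ j))"

lemma coordwise_nth [simp]: "coordwise t c v $ j = t c (v $ j)"
  by (simp add: coordwise_def)

lemma one_sidedD:
  assumes "one_sided t"
  shows "t c 0 = 0" "t c 1 = c" "t (- 1) x = - x"
  using assms by (auto simp: one_sided_def)

lemma one_sided_transitive:
  assumes "one_sided t" "x \<noteq> 0"
  shows "\<exists>c. t c x = y"
proof -
  have "(y * inverse x) * x = y" "x * (inverse x * y) = y"
    using assms(2) by (simp_all add: mult.assoc flip: mult.assoc[of x])
  with assms(1) show ?thesis unfolding one_sided_def by blast
qed

lemma submodule_coordwise_diff:
  assumes "one_sided t" "submodule (coordwise t) V" "u \<in> V" "v \<in> V"
  shows "u - v \<in> V"
proof -
  have "u + coordwise t (- 1) v \<in> V"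
    using assms(2-4) unfolding submodule_def by blast
  moreover have "u + coordwise t (- 1) v = u - v"
    using one_sidedD(3)[OF assms(1)] by (simp add: vec_eq_iff)
  ultimately show ?thesis by simp
qed

text \<open>The positions of the leading entries of the vectors in \<open>V\<close>, where \<open>e\<close> fixes the order of the
  coordinates. For a submodule their number is the dimension.\<close>

definition pivots :: "('k \<Rightarrow> nat) \<Rightarrow> ('a::zero ^ 'k) set \<Rightarrow> 'k set" where
  "pivots e V = {j. \<exists>v\<in>V. v $ j \<noteq> 0 \<and> (\<forall>i. e i < e j \<longrightarrow> v $ i = 0)}"

lemma pivots_mono: "V \<subseteq> W \<Longrightarrow> pivots e V \<subseteq> pivots e W"
  unfolding pivots_def by blast

text \<open>Gaussian elimination: a vector \<open>w\<close> of the larger module is approximated by vectors \<open>v\<close> of the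
  smaller one that agree with \<open>w\<close> on more and more coordinates. The first entry at which \<open>w - v\<close>
  does not vanish is a pivot of the larger module, hence of the smaller one, and a multiple of the
  vector with that pivot corrects \<open>v\<close> there without changing the earlier entries.\<close>

lemma pivots_determine_submodule:
  fixes V W :: "('a::division_ring ^ 'k::finite) set"
  assumes t: "one_sided t" and e: "inj e"
    and V: "submodule (coordwise t) V" and W: "submodule (coordwise t) W"
    and "V \<subseteq> W" and piv: "pivots e W \<subseteq> pivots e V"
  shows "W \<subseteq> V"
proof
  fix w assume "w \<in> W"
  have approx: "\<exists>v\<in>V. \<forall>i. e i < n \<longrightarrow> v $ i = w $ i" for n
  proof (induction n)
    case 0
    then show ?case using V by (auto simp: submodule_def)
  next
    case (Suc n)
    then obtain v where v: "v \<in> V" "\<And>i. e i < n \<Longrightarrow> v $ i = w $ i" by blast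
    show ?case
    proof (cases "\<exists>j. e j = n \<and> w $ j \<noteq> v $ j")
      case False
      then show ?thesis using v by (metis less_Suc_eq)
    next
      case True
      then obtain j where j: "e j = n" "w $ j \<noteq> v $ j" by blast
      have "w - v \<in> W"
        using submodule_coordwise_diff[OF t W] \<open>w \<in> W\<close> v(1) \<open>V \<subseteq> W\<close> by blast
      then have "j \<in> pivots e W"
        unfolding pivots_def using v(2) j by (auto intro!: bexI[of _ "w - v"])
      then obtain u where u: "u \<in> V" "u $ j \<noteq> 0" "\<And>i. e i < e j \<Longrightarrow> u $ i = 0"
        using piv unfolding pivots_def by blast
      obtain c where c: "t c (u $ j) = w $ j - v $ j"
        using one_sided_transitive[OF t u(2)] by blast
      have "v + coordwise t c u \<in> V"
        using V v(1) u(1) unfolding submodule_def by blast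
      moreover have "(v + coordwise t c u) $ i = w $ i" if "e i < Suc n" for i
      proof (cases "i = j")
        case True
        then show ?thesis using c by simp
      next
        case False
        then have "e i < n" using that j(1) e by (metis inj_eq less_Suc_eq)
        then show ?thesis using v(2) u(3) j(1) one_sidedD(1)[OF t] by simp
      qed
      ultimately show ?thesis by blast
    qed
  qed
  obtain v where v: "v \<in> V" "\<And>i. e i < Suc (Max (range e)) \<Longrightarrow> v $ i = w $ i"
    using approx by blast
  have "v = w" using v(2) by (simp add: vec_eq_iff le_imp_less_Suc)
  then show "w \<in> V" using v(1) by simp
qed

text \<open>If some \<open>V m\<close> were not contained in \<open>V k\<close>, then by the hypothesis \<open>stop\<close> each of the \<open>k + 1\<close>
  steps up to \<open>V (k + 1)\<close> would be strict and would add a pivot, but there are only \<open>k\<close> positions.\<close>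

lemma submodule_chain_stabilizes:
  fixes V :: "nat \<Rightarrow> ('a::division_ring ^ 'k::finite) set"
  assumes t: "one_sided t" and V: "\<And>d. submodule (coordwise t) (V d)" and mono: "mono V"
    and stop: "\<And>d m. V (Suc d) \<subseteq> V d \<Longrightarrow> V m \<subseteq> V d"
  shows "V m \<subseteq> V CARD('k)"
proof (rule ccontr)
  assume not: "\<not> V m \<subseteq> V CARD('k)"
  obtain e :: "'k \<Rightarrow> nat" where e: "inj e"
    using finite_imp_inj_to_nat_seg[of "UNIV :: 'k set"] by auto
  have "d \<le> card (pivots e (V d))" if "d \<le> Suc CARD('k)" for d
    using that
  proof (induction d)
    case (Suc d)
    then have "d \<le> CARD('k)" by simp
    then have "\<not> V (Suc d) \<subseteq> V d"
      using not stop[of d m] monoD[OF mono, of d "CARD('k)"] by blast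
    then have "\<not> pivots e (V (Suc d)) \<subseteq> pivots e (V d)"
      using pivots_determine_submodule[OF t e V V] monoD[OF mono, of d "Suc d"] by auto
    then have "pivots e (V d) \<subset> pivots e (V (Suc d))"
      using pivots_mono[OF monoD[OF mono, of d "Suc d"], of e] by auto
    then have "card (pivots e (V d)) < card (pivots e (V (Suc d)))"
      by (intro psubset_card_mono) simp_all
    then show ?case using Suc by simp
  qed simp
  from this[of "Suc CARD('k)"] card_mono[of UNIV "pivots e (V (Suc CARD('k)))"]
  show False by simp
qed

section \<open>Interpolation in a filtered module\<close>

text \<open>The common features of right and left evaluation at \<open>k\<close> points, with \<open>D n\<close> in the role of the
  polynomials of degree less than \<open>n\<close>. The assumption \<open>saturation\<close> is what remains of the
  multiplication: the value vectors stop growing at the first degree that contributes no new ones.\<close>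

locale filtered_evaluation =
  fixes t :: "'a::division_ring \<Rightarrow> 'a \<Rightarrow> 'a"
    and s :: "'a \<Rightarrow> 'm::ab_group_add \<Rightarrow> 'm"
    and ev :: "'m \<Rightarrow> 'a ^ 'k::finite"
    and D :: "nat \<Rightarrow> 'm set"
  assumes side: "one_sided t"
    and scale_add_right: "s c (x + y) = s c x + s c y"
    and scale_add_left: "s (c + d) x = s c x + s d x"
    and scale_one: "s 1 x = x"
    and scale_scale: "s c (s d x) = s (t c d) x"
    and ev_add: "ev (x + y) = ev x + ev y"
    and ev_scale: "ev (s c x) = coordwise t c (ev x)"
    and submodule_D: "submodule s (D n)"
    and D_mono: "D n \<subseteq> D (Suc n)"
    and D_exhaust: "\<exists>n. x \<in> D n"
    and saturation: "ev ` D (Suc n) \<subseteq> ev ` D n \<Longrightarrow> ev x \<in> ev ` D n"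
begin

lemma scale_zero: "s c 0 = 0" "s 0 x = 0"
  using scale_add_right[of c 0 0] scale_add_left[of 0 0 x] by simp_all

lemma ev_zero: "ev 0 = 0"
  using ev_add[of 0 0] by simp

lemma scale_sum: "s c (sum f A) = (\<Sum>x\<in>A. s c (f x))"
  by (induction A rule: infinite_finite_induct) (simp_all add: scale_zero scale_add_right)

lemma ev_sum: "ev (sum f A) = (\<Sum>x\<in>A. ev (f x))"
  by (induction A rule: infinite_finite_induct) (simp_all add: ev_zero ev_add)

lemma submodule_sum:
  assumes "submodule s N" "\<And>x. x \<in> A \<Longrightarrow> f x \<in> N"
  shows "sum f A \<in> N"
  using assms(2)
  by (induction A rule: infinite_finite_induct) (use assms(1) in \<open>auto simp: submodule_def\<close>)

lemma submodule_scale: "submodule s N \<Longrightarrow> x \<in> N \<Longrightarrow> s c x \<in> N"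
  by (simp add: submodule_def)

lemma submodule_hull: "submodule s (submodule s hull X)"
  unfolding hull_def submodule_def by blast

lemma submodule_ev_image: "submodule (coordwise t) (ev ` D d)"
proof -
  have "0 \<in> ev ` D d"
    using submodule_D[of d] ev_zero unfolding submodule_def by (metis imageI)
  then show ?thesis
    using submodule_D[of d] unfolding submodule_def
    by (auto simp flip: ev_add ev_scale)
qed

lemma evaluations_in_low_degree: "ev x \<in> ev ` D CARD('k)"
proof -
  obtain m where m: "x \<in> D m" using D_exhaust by blast
  have "ev ` D m \<subseteq> ev ` D CARD('k)"
  proof (rule submodule_chain_stabilizes[OF side, of "\<lambda>d. ev ` D d"])
    show "mono (\<lambda>d. ev ` D d)"
      using D_mono by (intro mono_iff_le_Suc[THEN iffD2]) auto
    show "ev ` D m \<subseteq> ev ` D d" if "ev ` D (Suc d) \<subseteq> ev ` D d" for d m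
      using saturation[OF that] by blast
  qed (rule submodule_ev_image)
  with m show ?thesis by blast
qed

lemma sum_scale_axis: "(\<Sum>i\<in>UNIV. coordwise t (v $ i) (axis i 1)) = v"
proof -
  have "(\<Sum>i\<in>UNIV. coordwise t (v $ i) (axis i 1)) $ j = v $ j" for j
  proof -
    have "(\<Sum>i\<in>UNIV. coordwise t (v $ i) (axis i 1)) $ j = (\<Sum>i\<in>UNIV. if i = j then v $ i else 0)"
      unfolding sum_component
      by (rule sum.cong) (auto simp: axis_def one_sidedD[OF side])
    then show ?thesis by simp
  qed
  then show ?thesis by (simp add: vec_eq_iff)
qed

text \<open>Multiples of separating elements have the unit vectors as values; their combinations take all
  values, and \<open>evaluations_in_low_degree\<close> replaces such a combination by an element of low degree.\<close>

lemma separated_iff_interpolation: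
  "(\<forall>j. \<exists>F. ev F $ j \<noteq> 0 \<and> (\<forall>i. i \<noteq> j \<longrightarrow> ev F $ i = 0)) \<longleftrightarrow>
   (\<forall>v. \<exists>F\<in>D CARD('k). ev F = v)" (is "?sep \<longleftrightarrow> ?int")
proof
  assume ?sep
  have "\<exists>F. ev F = axis j 1" for j
  proof -
    obtain F where F: "ev F $ j \<noteq> 0" "\<And>i. i \<noteq> j \<Longrightarrow> ev F $ i = 0" using \<open>?sep\<close> by blast
    obtain c where "t c (ev F $ j) = 1" using one_sided_transitive[OF side F(1)] by blast
    then have "ev (s c F) = axis j 1"
      using F(2) by (auto simp: vec_eq_iff ev_scale axis_def one_sidedD[OF side])
    then show ?thesis ..
  qed
  then obtain B where B: "\<And>j. ev (B j) = axis j 1" by metis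
  show ?int
  proof
    fix v
    have "ev (\<Sum>i\<in>UNIV. s (v $ i) (B i)) = v"
      by (simp add: ev_sum ev_scale B sum_scale_axis)
    then show "\<exists>F\<in>D CARD('k). ev F = v"
      using evaluations_in_low_degree by (metis imageE)
  qed
next
  assume int: ?int
  show ?sep
  proof
    fix j
    obtain F where "ev F = axis j 1" using int by blast
    then show "\<exists>F. ev F $ j \<noteq> 0 \<and> (\<forall>i. i \<noteq> j \<longrightarrow> ev F $ i = 0)"
      by (intro exI[of _ F]) (simp add: axis_def)
  qed
qed

text \<open>Elements \<open>F\<^sub>i\<close> whose value vectors are the unit vectors form a dual basis: each element of their
  span is the combination of the \<open>F\<^sub>i\<close> with its own values as coefficients, so that evaluation is
  injective on the span.\<close>

lemma interpolation_iff_isomorphism: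
  "(\<forall>v. \<exists>F\<in>D CARD('k). ev F = v) \<longleftrightarrow>
   (\<exists>F :: 'k \<Rightarrow> 'm. (\<forall>i. F i \<in> D CARD('k)) \<and>
      module_isomorphism_on s (coordwise t) (submodule s hull range F) UNIV ev)"
    (is "?int \<longleftrightarrow> ?iso")
proof
  assume ?int
  then have "\<forall>j. \<exists>F\<in>D CARD('k). ev F = axis j 1" by blast
  then obtain F where F: "\<And>j. F j \<in> D CARD('k)" "\<And>j. ev (F j) = axis j 1" by metis
  let ?H = "submodule s hull range F"
  \<comment> \<open>The elements that are recovered from their values by the dual basis.\<close>
  let ?N = "{G. G = (\<Sum>i\<in>UNIV. s (ev G $ i) (F i))}"
  have basis: "F j \<in> ?N" for j
  proof -
    have "(\<Sum>i\<in>UNIV. s (ev (F j) $ i) (F i)) = (\<Sum>i\<in>UNIV. if i = j then F i else 0)"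
      by (rule sum.cong) (auto simp: F(2) axis_def scale_zero scale_one)
    also have "\<dots> = F j" by simp
    finally have "F j = (\<Sum>i\<in>UNIV. s (ev (F j) $ i) (F i))" by (rule sym)
    then show ?thesis by (rule CollectI)
  qed
  have span: "submodule s ?N"
    unfolding submodule_def
  proof (intro conjI ballI allI)
    show "0 \<in> ?N" by (simp add: ev_zero scale_zero)
  next
    fix x y assume "x \<in> ?N" "y \<in> ?N"
    then have "x = (\<Sum>i\<in>UNIV. s (ev x $ i) (F i))" "y = (\<Sum>i\<in>UNIV. s (ev y $ i) (F i))"
      unfolding mem_Collect_eq .
    then have "x + y = (\<Sum>i\<in>UNIV. s (ev x $ i) (F i)) + (\<Sum>i\<in>UNIV. s (ev y $ i) (F i))"
      by (rule arg_cong2[where f = "(+)"])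
    also have "\<dots> = (\<Sum>i\<in>UNIV. s (ev (x + y) $ i) (F i))"
      by (simp add: scale_add_left sum.distrib ev_add)
    finally show "x + y \<in> ?N" by (rule CollectI)
  next
    fix c x assume "x \<in> ?N"
    then have "x = (\<Sum>i\<in>UNIV. s (ev x $ i) (F i))" by (rule CollectD)
    then have "s c x = s c (\<Sum>i\<in>UNIV. s (ev x $ i) (F i))"
      by (rule arg_cong[where f = "s c"])
    also have "\<dots> = (\<Sum>i\<in>UNIV. s (ev (s c x) $ i) (F i))"
      by (simp add: scale_sum scale_scale ev_scale)
    finally show "s c x \<in> ?N" by (rule CollectI)
  qed
  have coords: "x = (\<Sum>i\<in>UNIV. s (ev x $ i) (F i))" if "x \<in> ?H" for x
  proof -
    have "?H \<subseteq> ?N"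
    proof (rule hull_minimal)
      show "range F \<subseteq> ?N" by (rule image_subsetI) (rule basis)
    qed (rule span)
    then have "x \<in> ?N" using that by (rule subsetD)
    then show ?thesis by (rule CollectD)
  qed
  have "inj_on ev ?H"
  proof (rule inj_onI)
    fix x y assume xy: "x \<in> ?H" "y \<in> ?H" "ev x = ev y"
    have "x = (\<Sum>i\<in>UNIV. s (ev x $ i) (F i))"
      using xy(1) by (rule coords)
    also have "\<dots> = (\<Sum>i\<in>UNIV. s (ev y $ i) (F i))"
      by (simp only: xy(3))
    also have "\<dots> = y"
      using xy(2) by (rule coords[symmetric])
    finally show "x = y" .
  qed
  moreover have "ev ` ?H = UNIV"
  proof (rule UNIV_eq_I[symmetric])
    fix v
    have gen: "F i \<in> ?H" for i by (rule hull_inc) simp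
    have "(\<Sum>i\<in>UNIV. s (v $ i) (F i)) \<in> ?H"
      by (rule submodule_sum[OF submodule_hull submodule_scale[OF submodule_hull gen]])
    moreover have "v = ev (\<Sum>i\<in>UNIV. s (v $ i) (F i))"
      by (simp add: ev_sum ev_scale F(2) sum_scale_axis)
    ultimately show "v \<in> ev ` ?H" by (rule rev_image_eqI)
  qed
  ultimately have "module_isomorphism_on s (coordwise t) ?H UNIV ev"
    by (simp add: module_isomorphism_on_def bij_betw_def ev_add ev_scale)
  with F(1) show ?iso by (intro exI[of _ F] conjI allI)
next
  assume ?iso
  then show ?int
  proof (elim exE conjE)
    fix F :: "'k \<Rightarrow> 'm"
    assume F: "\<forall>i. F i \<in> D CARD('k)"
      and iso: "module_isomorphism_on s (coordwise t) (submodule s hull range F) UNIV ev"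
    have low: "submodule s hull range F \<subseteq> D CARD('k)"
    proof (rule hull_minimal)
      show "range F \<subseteq> D CARD('k)" using F by auto
    qed (rule submodule_D)
    show ?int
    proof
      fix v
      have "v \<in> ev ` (submodule s hull range F)"
        using iso unfolding module_isomorphism_on_def bij_betw_def by simp
      then obtain G where "v = ev G" "G \<in> submodule s hull range F" by (rule imageE)
      then show "\<exists>F\<in>D CARD('k). ev F = v"
        using low by (intro bexI[of _ G]) auto
    qed
  qed
qed

end

section \<open>Degrees in the skew polynomial ring\<close>

definition degree_below :: "nat \<Rightarrow> ('n, 'a::zero) skew_poly set" where
  "degree_below d = {F. \<forall>w\<in>Poly_Mapping.keys F. length w < d}"

lemma degree_below_zero: "0 \<in> degree_below d"
  by (simp add: degree_below_def)

lemma degree_below_add: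
  "F \<in> degree_below d \<Longrightarrow> G \<in> degree_below d \<Longrightarrow> F + G \<in> degree_below d"
  using Poly_Mapping.keys_add[of F G] unfolding degree_below_def by blast

lemma degree_below_sum:
  "(\<And>x. x \<in> A \<Longrightarrow> f x \<in> degree_below d) \<Longrightarrow> sum f A \<in> degree_below d"
  by (induction A rule: infinite_finite_induct) (auto intro: degree_below_zero degree_below_add)

lemma degree_below_single: "length w < d \<Longrightarrow> Poly_Mapping.single w c \<in> degree_below d"
  by (simp add: degree_below_def)

lemma degree_below_lscale:
  fixes F :: "('n, 'a::semiring_0) skew_poly"
  shows "F \<in> degree_below d \<Longrightarrow> lscale c F \<in> degree_below d"
  by (auto simp: degree_below_def in_keys_iff)

lemma degree_below_mono: "d \<le> e \<Longrightarrow> degree_below d \<subseteq> degree_below e"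
  by (auto simp: degree_below_def)

lemma degree_below_exhaust: "\<exists>d. F \<in> degree_below d"
proof
  show "F \<in> degree_below (Suc (Max (length ` Poly_Mapping.keys F)))"
    by (auto simp: degree_below_def less_Suc_eq_le)
qed

lemma skew_degree_less_card_iff:
  "skew_degree F < ereal (real CARD('k::finite)) \<longleftrightarrow> F \<in> degree_below CARD('k)"
  by (subst skew_degree_less_iff) (auto simp: degree_below_def Suc_le_eq)

lemma degree_below_var_mult:
  assumes "G \<in> degree_below d"
  shows "var_mult \<sigma> \<delta> i G \<in> degree_below (Suc d)"
  using assms unfolding var_mult_def
  by (auto simp: degree_below_def[of d] intro!: degree_below_sum degree_below_add degree_below_single
        dest!: bspec)

lemma degree_below_skew_mult:
  assumes "F \<in> degree_below d" "G \<in> degree_below (Suc e)"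
  shows "skew_mult \<sigma> \<delta> F G \<in> degree_below (d + e)"
proof -
  have word: "foldr (var_mult \<sigma> \<delta>) w G \<in> degree_below (length w + Suc e)" for w
    by (induction w) (use assms(2) in \<open>auto intro: degree_below_var_mult\<close>)
  have "foldr (var_mult \<sigma> \<delta>) w G \<in> degree_below (d + e)" if "w \<in> Poly_Mapping.keys F" for w
  proof -
    have "length w + Suc e \<le> d + e" using assms(1) that by (force simp: degree_below_def)
    then show ?thesis using word degree_below_mono by blast
  qed
  then show ?thesis
    unfolding skew_mult_def by (intro degree_below_sum degree_below_lscale)
qed

section \<open>Arithmetic of skew polynomials\<close>

locale skew_ring =
  fixes \<sigma> :: "'a::division_ring \<Rightarrow> 'a ^ 'n::finite ^ 'n" and \<delta> :: "'a \<Rightarrow> 'a ^ 'n"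
  assumes hom: "matrix_ring_hom \<sigma>" and der: "vector_derivation \<sigma> \<delta>"
begin

lemma sigma_additive [simp]: "\<sigma> (a + b) = \<sigma> a + \<sigma> b" "\<sigma> 0 = 0" "\<sigma> (sum f A) = (\<Sum>x\<in>A. \<sigma> (f x))"
  using hom Modules.additive.add Modules.additive.zero Modules.additive.sum
  unfolding matrix_ring_hom_def by blast+

lemma delta_additive [simp]: "\<delta> (a + b) = \<delta> a + \<delta> b" "\<delta> 0 = 0" "\<delta> (sum f A) = (\<Sum>x\<in>A. \<delta> (f x))"
  using der Modules.additive.add Modules.additive.zero Modules.additive.sum
  unfolding vector_derivation_def by blast+

lemma sigma_mult: "\<sigma> (a * b) $ i $ j = (\<Sum>k\<in>UNIV. \<sigma> a $ i $ k * \<sigma> b $ k $ j)"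
  using hom unfolding matrix_ring_hom_def by (simp add: matrix_matrix_mult_def)

lemma delta_mult: "\<delta> (a * b) $ i = (\<Sum>k\<in>UNIV. \<sigma> a $ i $ k * \<delta> b $ k) + \<delta> a $ i * b"
  using der unfolding vector_derivation_def by (simp add: matrix_vector_mult_def)

lemma sigma_delta_one: "\<sigma> 1 = mat 1" "\<delta> 1 = 0"
proof -
  show s: "\<sigma> 1 = mat 1" using hom by (simp add: matrix_ring_hom_def)
  have "\<delta> (1 * 1) = \<sigma> 1 *v \<delta> 1 + (\<chi> i. \<delta> 1 $ i * 1)"
    using der unfolding vector_derivation_def by blast
  then show "\<delta> 1 = 0" by (simp add: s vec_eq_iff)
qed

abbreviation mult (infixl "\<odot>" 70) where "F \<odot> G \<equiv> skew_mult \<sigma> \<delta> F G"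

abbreviation linear_factor :: "'a ^ 'n \<Rightarrow> 'n \<Rightarrow> ('n, 'a) skew_poly" where
  "linear_factor a i \<equiv> skew_var i - skew_const (a $ i)"

lemmas mult_distrib = skew_mult_distrib[OF hom der]
lemmas mult_zero = skew_mult_zero[OF hom der]
lemmas mult_assoc = skew_mult_assoc[OF hom der]
lemmas const_mult = skew_mult_const[OF hom der]
lemmas mult_one = skew_mult_one[OF hom der]

lemma mult_diff: "(F - F') \<odot> G = F \<odot> G - F' \<odot> G" "F \<odot> (G - G') = F \<odot> G - F \<odot> G'"
  using mult_distrib(1)[of "F - F'" F' G] mult_distrib(2)[of F "G - G'" G']
  by (simp_all add: algebra_simps)

lemma mult_sum: "F \<odot> sum f A = (\<Sum>x\<in>A. F \<odot> f x)" "sum f A \<odot> F = (\<Sum>x\<in>A. f x \<odot> F)"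
  by (induction A rule: infinite_finite_induct) (simp_all add: mult_distrib mult_zero)

lemma var_mult_eq: "var_mult \<sigma> \<delta> i F = skew_var i \<odot> F"
  by (simp add: skew_var_def skew_mult_single[OF hom der])

lemma var_mult_add: "var_mult \<sigma> \<delta> i (F + G) = var_mult \<sigma> \<delta> i F + var_mult \<sigma> \<delta> i G"
  by (simp add: var_mult_eq mult_distrib)

lemma var_mult_zero: "var_mult \<sigma> \<delta> i 0 = 0"
  by (simp add: var_mult_eq mult_zero)

lemma var_mult_single:
  "var_mult \<sigma> \<delta> i (Poly_Mapping.single w c) =
     (\<Sum>j\<in>UNIV. Poly_Mapping.single (j # w) (\<sigma> c $ i $ j)) + Poly_Mapping.single w (\<delta> c $ i)"
  by (cases "c = 0") (simp_all add: var_mult_def)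

lemma const_add: "skew_const (c + d) = skew_const c + skew_const d" and const_zero: "skew_const 0 = 0"
  by (simp_all add: skew_const_def single_add)

lemma const_mult_const: "skew_const (c * d) = skew_const c \<odot> skew_const d"
  unfolding const_mult by (simp add: skew_const_def)

lemma single_eq_const_mult: "Poly_Mapping.single w c = skew_const c \<odot> Poly_Mapping.single w 1"
  by (simp add: const_mult)

lemma single_Cons_one: "Poly_Mapping.single (i # w) 1 = skew_var i \<odot> Poly_Mapping.single w 1"
  using skew_mult_monomials[OF hom der, of "[i]" w] by (simp add: skew_var_def)

lemma single_snoc: "Poly_Mapping.single (w @ [i]) c = Poly_Mapping.single w c \<odot> skew_var i"
  unfolding single_eq_const_mult[of w c] mult_assoc
  using skew_mult_monomials[OF hom der, of w "[i]"]
  by (simp add: skew_var_def const_mult)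

lemma var_mult_const:
  "skew_var i \<odot> skew_const c =
     (\<Sum>j\<in>UNIV. skew_const (\<sigma> c $ i $ j) \<odot> skew_var j) + skew_const (\<delta> c $ i)"
  by (rule skew_var_mult_const[OF hom der])

section \<open>Right evaluation\<close>

text \<open>The value at \<open>a\<close> of the product \<open>x\<^sub>i c\<close> with \<open>c\<close> a constant: the remainder of
  \<open>\<Sum>\<^sub>j \<sigma>\<^sub>i\<^sub>j(c) x\<^sub>j + \<delta>\<^sub>i(c)\<close> on right division by the \<open>x\<^sub>j - a\<^sub>j\<close>.\<close>

definition right_step :: "'a ^ 'n \<Rightarrow> 'n \<Rightarrow> 'a \<Rightarrow> 'a" where
  "right_step a i c = (\<Sum>j\<in>UNIV. \<sigma> c $ i $ j * a $ j) + \<delta> c $ i"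

text \<open>The variables of a word are applied from the last to the first, as \<open>x\<^sub>i w\<close> arises from \<open>w\<close> by left
  multiplication.\<close>

definition right_val :: "'a ^ 'n \<Rightarrow> ('n, 'a) skew_poly \<Rightarrow> 'a" where
  "right_val a F =
     (\<Sum>w\<in>Poly_Mapping.keys F. Poly_Mapping.lookup F w * foldr (right_step a) w 1)"

lemma right_step_additive: "right_step a i (c + d) = right_step a i c + right_step a i d"
    "right_step a i 0 = 0"
  by (simp_all add: right_step_def sum.distrib algebra_simps)

text \<open>The multiplication rules of \<open>\<sigma>\<close> and \<open>\<delta>\<close> say that \<open>(x\<^sub>i c) d = x\<^sub>i (c d)\<close>; this is the same
  identity after evaluation, and it makes \<open>right_val\<close> compatible with left multiplication.\<close>

lemma right_step_mult:
  "right_step a i (c * d) = (\<Sum>j\<in>UNIV. \<sigma> c $ i $ j * right_step a j d) + \<delta> c $ i * d"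
proof -
  have "(\<Sum>j\<in>UNIV. \<Sum>k\<in>UNIV. \<sigma> c $ i $ k * \<sigma> d $ k $ j * a $ j) =
      (\<Sum>k\<in>UNIV. \<Sum>j\<in>UNIV. \<sigma> c $ i $ k * \<sigma> d $ k $ j * a $ j)"
    by (rule sum.swap)
  then show ?thesis
    by (simp add: right_step_def sigma_mult delta_mult sum_distrib_left sum_distrib_right
        sum.distrib distrib_left mult.assoc)
qed

lemma right_val_zero: "right_val a 0 = 0"
  by (simp add: right_val_def)

lemma right_val_add: "right_val a (F + G) = right_val a F + right_val a G"
  unfolding right_val_def by (rule sum_keys_additive) (simp_all add: distrib_right)

lemma right_val_sum: "right_val a (sum f A) = (\<Sum>x\<in>A. right_val a (f x))"
  by (induction A rule: infinite_finite_induct) (simp_all add: right_val_zero right_val_add)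

lemma right_val_single: "right_val a (Poly_Mapping.single w c) = c * foldr (right_step a) w 1"
  by (simp add: right_val_def)

lemma right_val_const: "right_val a (skew_const c) = c"
  by (simp add: skew_const_def right_val_single)

lemma right_val_lscale: "right_val a (lscale c F) = c * right_val a F"
  by (induction F rule: skew_poly_induct)
    (simp_all add: right_val_zero right_val_add right_val_single distrib_left mult.assoc)

lemma right_val_var_mult: "right_val a (var_mult \<sigma> \<delta> i F) = right_step a i (right_val a F)"
  by (induction F rule: skew_poly_induct)
    (simp_all add: right_val_zero right_val_add right_val_sum right_val_single var_mult_zero
      var_mult_add var_mult_single right_step_additive right_step_mult mult.assoc)

lemma right_val_linear_factor: "right_val a (linear_factor a i) = 0"
proof -
  have "right_val a (skew_var i) = (\<Sum>j\<in>UNIV. if j = i then a $ j else 0)"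
    unfolding skew_var_def right_val_single
    by (simp add: right_step_def sigma_delta_one mat_def if_distrib if_distribR cong: if_cong)
  moreover have "right_val a (skew_var i) = right_val a (linear_factor a i) + a $ i"
    using right_val_add[of a "linear_factor a i" "skew_const (a $ i)"]
    by (simp add: right_val_const)
  ultimately show ?thesis by simp
qed

text \<open>Given \<open>F\<close>, the value of \<open>F G\<close> at \<open>a\<close> is a function of the value of \<open>G\<close>, computed by one
  additive step for each variable of \<open>F\<close>, so the polynomials vanishing at \<open>a\<close> form a left ideal.\<close>

lemma right_val_mult_eq_0:
  assumes "right_val a G = 0"
  shows "right_val a (F \<odot> G) = 0"
proof -
  have "right_val a (foldr (var_mult \<sigma> \<delta>) w G) = 0" for w
    by (induction w) (simp_all add: assms right_val_var_mult right_step_additive)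
  then show ?thesis by (simp add: skew_mult_def right_val_sum right_val_lscale)
qed

lemma right_remainder_exists:
  "\<exists>G c. F = (\<Sum>i\<in>UNIV. G i \<odot> linear_factor a i) + skew_const c"
proof (induction F rule: skew_poly_induct)
  case zero
  show ?case
    by (intro exI[of _ "\<lambda>_. 0"] exI[of _ 0]) (simp add: mult_zero const_zero)
next
  case (add F F')
  then obtain G c G' c' where "F = (\<Sum>i\<in>UNIV. G i \<odot> linear_factor a i) + skew_const c"
    "F' = (\<Sum>i\<in>UNIV. G' i \<odot> linear_factor a i) + skew_const c'" by blast
  then show ?case
    by (intro exI[of _ "\<lambda>i. G i + G' i"] exI[of _ "c + c'"])
      (simp add: mult_distrib sum.distrib const_add)
next
  case (single w c)
  have "\<exists>G d. Poly_Mapping.single w 1 = (\<Sum>i\<in>UNIV. G i \<odot> linear_factor a i) + skew_const d"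
  proof (induction w)
    case Nil
    show ?case
      by (intro exI[of _ "\<lambda>_. 0"] exI[of _ 1]) (simp add: mult_zero skew_const_def)
  next
    case (Cons j w)
    then obtain G d where
      G: "Poly_Mapping.single w 1 = (\<Sum>i\<in>UNIV. G i \<odot> linear_factor a i) + skew_const d" by blast
    \<comment> \<open>The coefficients of \<open>x\<^sub>j d = \<Sum>\<^sub>i \<sigma>\<^sub>j\<^sub>i(d) (x\<^sub>i - a\<^sub>i) + e\<close> enter the new quotients and remainder.\<close>
    let ?e = "(\<Sum>i\<in>UNIV. \<sigma> d $ j $ i * a $ i) + \<delta> d $ j"
    let ?G = "\<lambda>i. skew_var j \<odot> G i + skew_const (\<sigma> d $ j $ i)"
    have const_sum: "skew_const (sum f A) = (\<Sum>i\<in>A. skew_const (f i))"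
      for f :: "'n \<Rightarrow> 'a" and A
      by (induction A rule: infinite_finite_induct) (simp_all add: const_zero const_add)
    have "Poly_Mapping.single (j # w) 1 =
        (\<Sum>i\<in>UNIV. skew_var j \<odot> G i \<odot> linear_factor a i) + skew_var j \<odot> skew_const d"
      by (simp add: single_Cons_one G mult_distrib mult_sum mult_assoc)
    also have "\<dots> = (\<Sum>i\<in>UNIV. ?G i \<odot> linear_factor a i) + skew_const ?e"
      by (simp add: var_mult_const mult_distrib mult_diff const_add const_sum const_mult_const
          sum.distrib sum_subtractf)
    finally show ?case by (intro exI[of _ ?G] exI[of _ ?e])
  qed
  then obtain G d where
    G: "Poly_Mapping.single w 1 = (\<Sum>i\<in>UNIV. G i \<odot> linear_factor a i) + skew_const d" by blast
  have "Poly_Mapping.single w c =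
      (\<Sum>i\<in>UNIV. (skew_const c \<odot> G i) \<odot> linear_factor a i) + skew_const c \<odot> skew_const d"
    unfolding single_eq_const_mult[of w c] G mult_distrib mult_sum mult_assoc ..
  also have "skew_const c \<odot> skew_const d = skew_const (c * d)"
    by (rule const_mult_const[symmetric])
  finally show ?case
    by (intro exI[of _ "\<lambda>i. skew_const c \<odot> G i"] exI[of _ "c * d"])
qed

lemma right_eval_eq: "right_eval \<sigma> \<delta> F a = right_val a F"
proof -
  have val: "right_val a F = c"
    if "F = (\<Sum>i\<in>UNIV. G i \<odot> linear_factor a i) + skew_const c" for G c
    using that
    by (simp add: right_val_add right_val_sum right_val_const
        right_val_mult_eq_0[OF right_val_linear_factor])
  obtain G c where G: "F = (\<Sum>i\<in>UNIV. G i \<odot> linear_factor a i) + skew_const c"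
    using right_remainder_exists by blast
  show ?thesis
    unfolding right_eval_def
  proof (rule the_equality)
    show "\<exists>G. F = (\<Sum>i\<in>UNIV. G i \<odot> linear_factor a i) + skew_const (right_val a F)"
      unfolding val[OF G] by (intro exI[of _ G]) (rule G)
  qed (elim exE, rule val[symmetric])
qed

text \<open>For saturation a word is shortened from the left: \<open>w\<close> may be replaced by a polynomial \<open>H\<close> of
  degree less than \<open>d\<close> with the same values, then \<open>x\<^sub>i w\<close> by \<open>x\<^sub>i H\<close>, whose degree is less than
  \<open>d + 1\<close>. Coefficients are handled last, by left linearity.\<close>

lemma right_eval_filtered:
  "filtered_evaluation (\<lambda>c x. c * x) lscale
     (\<lambda>F. \<chi> j :: 'k::finite. right_eval \<sigma> \<delta> F (a j)) degree_below"
proof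
  fix d :: nat and F :: "('n, 'a) skew_poly"
  let ?ev = "\<lambda>F. \<chi> j. right_val (a j) F"
  have ev_var: "?ev (var_mult \<sigma> \<delta> i F) = ?ev (var_mult \<sigma> \<delta> i G)" if "?ev F = ?ev G" for i F G
    using that by (simp add: vec_eq_iff right_val_var_mult)
  show "submodule lscale (degree_below d :: ('n, 'a) skew_poly set)"
    by (simp add: submodule_def degree_below_zero degree_below_add degree_below_lscale)
  show "degree_below d \<subseteq> (degree_below (Suc d) :: ('n, 'a) skew_poly set)"
    by (rule degree_below_mono) simp
  show "\<exists>d. F \<in> degree_below d" by (rule degree_below_exhaust)
  assume "(\<lambda>F. \<chi> j. right_eval \<sigma> \<delta> F (a j)) ` degree_below (Suc d) \<subseteq>
      (\<lambda>F. \<chi> j. right_eval \<sigma> \<delta> F (a j)) ` degree_below d"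
  then have sub: "?ev ` degree_below (Suc d) \<subseteq> ?ev ` degree_below d"
    unfolding right_eval_eq .
  have red: "\<exists>H\<in>degree_below d. ?ev G = ?ev H" if "G \<in> degree_below (Suc d)" for G
    using subsetD[OF sub imageI[OF that]] unfolding image_iff .
  have "\<exists>H\<in>degree_below d. ?ev F = ?ev H"
  proof (induction F rule: skew_poly_induct)
    case zero
    show ?case using degree_below_zero by blast
  next
    case (add F F')
    then obtain H H' where H: "H \<in> degree_below d" "H' \<in> degree_below d"
      "?ev F = ?ev H" "?ev F' = ?ev H'" by blast
    then have "?ev (F + F') = ?ev (H + H')" by (simp add: vec_eq_iff right_val_add)
    then show ?case by (intro bexI[of _ "H + H'"] degree_below_add H)
  next
    case (single w c)
    have "\<exists>H\<in>degree_below d. ?ev (Poly_Mapping.single w 1) = ?ev H"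
    proof (induction w)
      case Nil
      show ?case by (rule red) (simp add: degree_below_single)
    next
      case (Cons i w)
      then obtain H where H: "H \<in> degree_below d" "?ev (Poly_Mapping.single w 1) = ?ev H" by blast
      show ?case
        using red[OF degree_below_var_mult[OF H(1)], of \<sigma> \<delta> i] ev_var[OF H(2), of i]
        by (simp only: single_Cons_one var_mult_eq)
    qed
    then obtain H where "H \<in> degree_below d" "?ev (Poly_Mapping.single w 1) = ?ev H" by blast
    then show ?case
      using right_val_lscale[of _ c "Poly_Mapping.single w 1"]
      by (intro bexI[of _ "lscale c H"])
        (auto simp: vec_eq_iff right_val_lscale intro: degree_below_lscale)
  qed
  then show "(\<chi> j. right_eval \<sigma> \<delta> F (a j)) \<in> (\<lambda>F. \<chi> j. right_eval \<sigma> \<delta> F (a j)) ` degree_below d"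
    unfolding right_eval_eq by (simp only: image_iff)
qed (simp_all add: one_sided_def vec_eq_iff right_eval_eq right_val_add right_val_lscale)

section \<open>Left evaluation\<close>

text \<open>The left value of \<open>c x\<^sub>i\<close> at \<open>a\<close>. The vector \<open>\<gamma>\<close> moves the coefficient to the right: by
  definition of \<open>\<phi>\<close>, \<open>\<Sum>\<^sub>j x\<^sub>j \<gamma>\<^sub>j = c x\<^sub>i + \<Sum>\<^sub>j \<delta>\<^sub>j(\<gamma>\<^sub>j)\<close>, and then \<open>a\<^sub>j\<close> is put for \<open>x\<^sub>j\<close>.\<close>

definition left_step :: "'a ^ 'n \<Rightarrow> 'n \<Rightarrow> 'a \<Rightarrow> 'a" where
  "left_step a i c =
     (let \<gamma> = inv (phi_map \<sigma>) (axis i c) in \<Sum>j\<in>UNIV. a $ j * \<gamma> $ j - \<delta> (\<gamma> $ j) $ j)"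

text \<open>The coefficient passes through the word from left to right, each variable in turn being evaluated
  and absorbed into the coefficient of the rest.\<close>

definition left_val :: "'a ^ 'n \<Rightarrow> ('n, 'a) skew_poly \<Rightarrow> 'a" where
  "left_val a F = (\<Sum>w\<in>Poly_Mapping.keys F. fold (left_step a) w (Poly_Mapping.lookup F w))"

end

locale invertible_skew_ring = skew_ring \<sigma> \<delta>
  for \<sigma> :: "'a::division_ring \<Rightarrow> 'a ^ 'n::finite ^ 'n" and \<delta> :: "'a \<Rightarrow> 'a ^ 'n" +
  assumes phi: "additive_group_iso (phi_map \<sigma>)"
begin

lemma phi_inv: "phi_map \<sigma> (inv (phi_map \<sigma>) v) = v" "inv (phi_map \<sigma>) (phi_map \<sigma> v) = v"
  using phi by (simp_all add: additive_group_iso_def bij_is_surj surj_f_inv_f bij_is_inj)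

lemma phi_add: "phi_map \<sigma> (v + w) = phi_map \<sigma> v + phi_map \<sigma> w"
  using phi by (simp add: additive_group_iso_def Modules.additive.add)

lemma inv_phi_add:
  "inv (phi_map \<sigma>) (v + w) = inv (phi_map \<sigma>) v + inv (phi_map \<sigma>) w"
  using phi_inv(2)[of "inv (phi_map \<sigma>) v + inv (phi_map \<sigma>) w"]
  unfolding phi_add phi_inv(1) .

lemma inv_phi_zero: "inv (phi_map \<sigma>) 0 = 0"
  using inv_phi_add[of 0 0] by simp

lemma inv_phi_sum: "inv (phi_map \<sigma>) (sum f A) = (\<Sum>x\<in>A. inv (phi_map \<sigma>) (f x))"
  by (induction A rule: infinite_finite_induct) (simp_all add: inv_phi_zero inv_phi_add)

lemma left_step_additive: "left_step a i (c + d) = left_step a i c + left_step a i d"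
    "left_step a i 0 = 0"
proof -
  have axis: "axis i (c + d) = axis i c + axis i d" "axis i 0 = (0 :: 'a ^ 'n)"
    by (auto simp: axis_def vec_eq_iff)
  show "left_step a i (c + d) = left_step a i c + left_step a i d" "left_step a i 0 = 0"
    by (simp_all add: left_step_def Let_def axis inv_phi_add inv_phi_zero distrib_left
        sum.distrib sum_subtractf)
qed

text \<open>The left value of \<open>x\<^sub>j b\<close> has to be \<open>a\<^sub>j b\<close>, and \<open>x\<^sub>j b = \<Sum>\<^sub>i \<sigma>\<^sub>j\<^sub>i(b) x\<^sub>i + \<delta>\<^sub>j(b)\<close>. It holds as the
  row \<open>(\<sigma>\<^sub>j\<^sub>i(b))\<^sub>i\<close> is the image under \<open>\<phi>\<close> of the vector with the single entry \<open>b\<close> at \<open>j\<close>.\<close>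

lemma left_step_sum_sigma:
  "(\<Sum>i\<in>UNIV. left_step a i (\<sigma> b $ j $ i)) = a $ j * b - \<delta> b $ j"
proof -
  let ?g = "\<lambda>i. inv (phi_map \<sigma>) (axis i (\<sigma> b $ j $ i))"
  have "phi_map \<sigma> (axis j b) = \<sigma> b $ j"
  proof -
    have "(\<Sum>l\<in>UNIV. \<sigma> (axis j b $ l) $ l $ i) = (\<Sum>l\<in>UNIV. if l = j then \<sigma> b $ l $ i else 0)" for i
      by (rule sum.cong) (auto simp: axis_def)
    then show ?thesis by (simp add: phi_map_def vec_eq_iff)
  qed
  moreover have "(\<Sum>i\<in>UNIV. axis i (\<sigma> b $ j $ i)) = \<sigma> b $ j"
    by (simp add: vec_eq_iff axis_def)
  ultimately have "inv (phi_map \<sigma>) (\<Sum>i\<in>UNIV. axis i (\<sigma> b $ j $ i)) = axis j b"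
    using phi_inv(2)[of "axis j b"] by simp
  then have g: "(\<Sum>i\<in>UNIV. ?g i $ l) = axis j b $ l" for l
    unfolding inv_phi_sum by (simp only: flip: sum_component)
  have "(\<Sum>i\<in>UNIV. left_step a i (\<sigma> b $ j $ i)) =
      (\<Sum>l\<in>UNIV. \<Sum>i\<in>UNIV. a $ l * ?g i $ l - \<delta> (?g i $ l) $ l)"
    unfolding left_step_def Let_def by (rule sum.swap)
  also have "\<dots> = (\<Sum>l\<in>UNIV. a $ l * axis j b $ l - \<delta> (axis j b $ l) $ l)"
    unfolding g[symmetric] by (simp add: sum_subtractf sum_distrib_left)
  also have "\<dots> = (\<Sum>l\<in>UNIV. if l = j then a $ l * b - \<delta> b $ l else 0)"
    by (rule sum.cong) (auto simp: axis_def)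
  finally show ?thesis by simp
qed

lemma fold_left_step_additive:
  "fold (left_step a) w (c + d) = fold (left_step a) w c + fold (left_step a) w d"
  "fold (left_step a) w 0 = 0"
  by (induction w arbitrary: c d) (simp_all add: left_step_additive)

lemma fold_left_step_sum:
  "fold (left_step a) w (sum f A) = (\<Sum>x\<in>A. fold (left_step a) w (f x))"
  by (induction A rule: infinite_finite_induct) (simp_all add: fold_left_step_additive)

lemma left_val_zero: "left_val a 0 = 0"
  by (simp add: left_val_def)

lemma left_val_add: "left_val a (F + G) = left_val a F + left_val a G"
  unfolding left_val_def by (rule sum_keys_additive) (simp_all add: fold_left_step_additive)

lemma left_val_sum: "left_val a (sum f A) = (\<Sum>x\<in>A. left_val a (f x))"
  by (induction A rule: infinite_finite_induct) (simp_all add: left_val_zero left_val_add)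

lemma left_val_single: "left_val a (Poly_Mapping.single w c) = fold (left_step a) w c"
  by (simp add: left_val_def fold_left_step_additive)

lemma left_val_const: "left_val a (skew_const c) = c"
  by (simp add: skew_const_def left_val_single)

text \<open>A variable appended to a word is the last one to be absorbed.\<close>

lemma left_val_mult_var: "left_val a (F \<odot> skew_var i) = left_step a i (left_val a F)"
  by (induction F rule: skew_poly_induct)
    (simp_all add: mult_zero mult_distrib left_val_zero left_val_add left_step_additive
      left_val_single flip: single_snoc)

lemma left_val_linear_factor_mult: "left_val a (linear_factor a j \<odot> F) = 0"
proof -
  have "left_val a (skew_var j \<odot> F) = left_val a (skew_const (a $ j) \<odot> F)"
  proof (induction F rule: skew_poly_induct)
    case (single w b)
    have "left_val a (skew_var j \<odot> Poly_Mapping.single w b) =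
        fold (left_step a) w ((\<Sum>i\<in>UNIV. left_step a i (\<sigma> b $ j $ i)) + \<delta> b $ j)"
      by (simp add: var_mult_single left_val_add left_val_sum left_val_single
          fold_left_step_additive fold_left_step_sum flip: var_mult_eq)
    also have "\<dots> = fold (left_step a) w (a $ j * b)"
      by (simp add: left_step_sum_sigma)
    finally show ?case by (simp add: const_mult left_val_single)
  qed (simp_all add: mult_zero mult_distrib left_val_add)
  then show ?thesis
    using left_val_add[of a "linear_factor a j \<odot> F" "skew_const (a $ j) \<odot> F"]
    by (simp add: mult_diff)
qed

lemma left_remainder_exists:
  "\<exists>G c. F = (\<Sum>i\<in>UNIV. linear_factor a i \<odot> G i) + skew_const c"
proof (induction F rule: skew_poly_induct)
  case zero
  show ?case
    by (intro exI[of _ "\<lambda>_. 0"] exI[of _ 0]) (simp add: mult_zero const_zero)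
next
  case (add F F')
  then obtain G c G' c' where "F = (\<Sum>i\<in>UNIV. linear_factor a i \<odot> G i) + skew_const c"
    "F' = (\<Sum>i\<in>UNIV. linear_factor a i \<odot> G' i) + skew_const c'" by blast
  then show ?case
    by (intro exI[of _ "\<lambda>i. G i + G' i"] exI[of _ "c + c'"])
      (simp add: mult_distrib sum.distrib const_add)
next
  case (single w c)
  show ?case
  proof (induction w arbitrary: c)
    case Nil
    show ?case
      by (intro exI[of _ "\<lambda>_. 0"] exI[of _ c]) (simp add: mult_zero skew_const_def)
  next
    case (Cons k w)
    \<comment> \<open>With this \<open>\<gamma>\<close>, the term \<open>c x\<^sub>k w\<close> differs from \<open>\<Sum>\<^sub>j (x\<^sub>j - a\<^sub>j) \<gamma>\<^sub>j w\<close> by a multiple of \<open>w\<close>.\<close>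
    define \<gamma> where "\<gamma> = inv (phi_map \<sigma>) (axis k c)"
    have single_sum: "(\<Sum>x\<in>A. Poly_Mapping.single u (f x)) = Poly_Mapping.single u (sum f A)"
      for f :: "'n \<Rightarrow> 'a" and A and u :: "'n list"
      by (induction A rule: infinite_finite_induct) (simp_all add: single_add)
    have \<gamma>: "(\<Sum>j\<in>UNIV. \<sigma> (\<gamma> $ j) $ j $ i) = axis k c $ i" for i
      using phi_inv(1)[of "axis k c"] unfolding \<gamma>_def[symmetric]
      by (simp add: phi_map_def vec_eq_iff)
    have "(\<Sum>j\<in>UNIV. \<Sum>i\<in>UNIV. Poly_Mapping.single (i # w) (\<sigma> (\<gamma> $ j) $ j $ i)) =
        (\<Sum>i\<in>UNIV. Poly_Mapping.single (i # w) (axis k c $ i))"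
      by (subst sum.swap) (simp add: single_sum \<gamma>)
    also have "\<dots> = (\<Sum>i\<in>UNIV. if i = k then Poly_Mapping.single (i # w) c else 0)"
      by (rule sum.cong) (auto simp: axis_def)
    finally have top: "(\<Sum>j\<in>UNIV. \<Sum>i\<in>UNIV. Poly_Mapping.single (i # w) (\<sigma> (\<gamma> $ j) $ j $ i)) =
        Poly_Mapping.single (k # w) c" by simp
    obtain G d where G: "Poly_Mapping.single w (\<Sum>j\<in>UNIV. a $ j * \<gamma> $ j - \<delta> (\<gamma> $ j) $ j) =
        (\<Sum>i\<in>UNIV. linear_factor a i \<odot> G i) + skew_const d"
      using Cons.IH by blast
    have "(\<Sum>j\<in>UNIV. linear_factor a j \<odot> Poly_Mapping.single w (\<gamma> $ j)) =
        Poly_Mapping.single (k # w) c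
          - Poly_Mapping.single w (\<Sum>j\<in>UNIV. a $ j * \<gamma> $ j - \<delta> (\<gamma> $ j) $ j)"
      by (simp add: mult_diff const_mult var_mult_single sum.distrib sum_subtractf top
          single_sum single_diff flip: var_mult_eq)
    then have "Poly_Mapping.single (k # w) c =
        (\<Sum>i\<in>UNIV. linear_factor a i \<odot> (G i + Poly_Mapping.single w (\<gamma> $ i))) + skew_const d"
      by (simp add: mult_distrib sum.distrib G algebra_simps)
    then show ?case
      by (intro exI[of _ "\<lambda>i. G i + Poly_Mapping.single w (\<gamma> $ i)"] exI[of _ d])
  qed
qed

lemma left_val_remainder:
  "F = (\<Sum>i\<in>UNIV. linear_factor a i \<odot> G i) + skew_const c \<Longrightarrow> left_val a F = c"
  by (simp add: left_val_add left_val_sum left_val_const left_val_linear_factor_mult)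

lemma left_eval_eq: "left_eval \<sigma> \<delta> F a = left_val a F"
proof -
  obtain G c where G: "F = (\<Sum>i\<in>UNIV. linear_factor a i \<odot> G i) + skew_const c"
    using left_remainder_exists by blast
  show ?thesis
    unfolding left_eval_def
  proof (rule the_equality)
    show "\<exists>G. F = (\<Sum>i\<in>UNIV. linear_factor a i \<odot> G i) + skew_const (left_val a F)"
      unfolding left_val_remainder[OF G] by (intro exI[of _ G]) (rule G)
  qed (elim exE, rule left_val_remainder[symmetric])
qed

text \<open>Multiplying a division with remainder by the constant \<open>c\<close> from the right gives one for the
  product.\<close>

lemma left_val_rscale: "left_val a (rscale \<sigma> \<delta> c F) = left_val a F * c"
proof -
  obtain G d where G: "F = (\<Sum>i\<in>UNIV. linear_factor a i \<odot> G i) + skew_const d"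
    using left_remainder_exists by blast
  have "F \<odot> skew_const c =
      (\<Sum>i\<in>UNIV. linear_factor a i \<odot> (G i \<odot> skew_const c)) + skew_const d \<odot> skew_const c"
    unfolding G mult_distrib mult_sum mult_assoc ..
  also have "skew_const d \<odot> skew_const c = skew_const (d * c)"
    by (rule const_mult_const[symmetric])
  finally have "rscale \<sigma> \<delta> c F =
      (\<Sum>i\<in>UNIV. linear_factor a i \<odot> (G i \<odot> skew_const c)) + skew_const (d * c)"
    by (simp add: rscale_def)
  from left_val_remainder[OF this] left_val_remainder[OF G] show ?thesis by simp
qed

lemma degree_below_rscale: "F \<in> degree_below d \<Longrightarrow> rscale \<sigma> \<delta> c F \<in> degree_below d"
  using degree_below_skew_mult[of F d "skew_const c" 0 \<sigma> \<delta>]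
  by (simp add: rscale_def skew_const_def degree_below_single)

text \<open>For saturation a word is shortened from the right. The coefficient stays in front of the word
  throughout, since left evaluation is not linear for the left scalars.\<close>

lemma left_eval_filtered:
  "filtered_evaluation (\<lambda>c x. x * c) (rscale \<sigma> \<delta>)
     (\<lambda>F. \<chi> j :: 'k::finite. left_eval \<sigma> \<delta> F (a j)) degree_below"
proof
  fix d :: nat and F :: "('n, 'a) skew_poly"
  let ?ev = "\<lambda>F. \<chi> j. left_val (a j) F"
  have ev_var: "?ev (F \<odot> skew_var i) = ?ev (G \<odot> skew_var i)" if "?ev F = ?ev G" for i F G
    using that by (simp add: vec_eq_iff left_val_mult_var)
  show "submodule (rscale \<sigma> \<delta>) (degree_below d)"
    by (simp add: submodule_def degree_below_zero degree_below_add degree_below_rscale)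
  show "degree_below d \<subseteq> (degree_below (Suc d) :: ('n, 'a) skew_poly set)"
    by (rule degree_below_mono) simp
  show "\<exists>d. F \<in> degree_below d" by (rule degree_below_exhaust)
  assume "(\<lambda>F. \<chi> j. left_eval \<sigma> \<delta> F (a j)) ` degree_below (Suc d) \<subseteq>
      (\<lambda>F. \<chi> j. left_eval \<sigma> \<delta> F (a j)) ` degree_below d"
  then have sub: "?ev ` degree_below (Suc d) \<subseteq> ?ev ` degree_below d"
    unfolding left_eval_eq .
  have red: "\<exists>H\<in>degree_below d. ?ev G = ?ev H" if "G \<in> degree_below (Suc d)" for G
    using subsetD[OF sub imageI[OF that]] unfolding image_iff .
  have "\<exists>H\<in>degree_below d. ?ev F = ?ev H"
  proof (induction F rule: skew_poly_induct)
    case zero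
    show ?case using degree_below_zero by blast
  next
    case (add F F')
    then obtain H H' where H: "H \<in> degree_below d" "H' \<in> degree_below d"
      "?ev F = ?ev H" "?ev F' = ?ev H'" by blast
    then have "?ev (F + F') = ?ev (H + H')" by (simp add: vec_eq_iff left_val_add)
    then show ?case by (intro bexI[of _ "H + H'"] degree_below_add H)
  next
    case (single w c)
    show ?case
    proof (induction w rule: rev_induct)
      case Nil
      show ?case by (rule red) (simp add: degree_below_single)
    next
      case (snoc i w)
      then obtain H where H: "H \<in> degree_below d" "?ev (Poly_Mapping.single w c) = ?ev H" by blast
      have "H \<odot> skew_var i \<in> degree_below (Suc d)"
        using degree_below_skew_mult[OF H(1), of "skew_var i" 1 \<sigma> \<delta>]
        by (simp add: skew_var_def degree_below_single)
      from red[OF this] ev_var[OF H(2), of i] show ?case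
        by (simp only: single_snoc)
    qed
  qed
  then show "(\<chi> j. left_eval \<sigma> \<delta> F (a j)) \<in> (\<lambda>F. \<chi> j. left_eval \<sigma> \<delta> F (a j)) ` degree_below d"
    unfolding left_eval_eq by (simp only: image_iff)
next
  fix c d and F :: "('n, 'a) skew_poly"
  show "rscale \<sigma> \<delta> c (rscale \<sigma> \<delta> d F) = rscale \<sigma> \<delta> (d * c) F"
    by (simp add: rscale_def mult_assoc const_mult_const)
next
  fix c d and F G :: "('n, 'a) skew_poly"
  show "rscale \<sigma> \<delta> c (F + G) = rscale \<sigma> \<delta> c F + rscale \<sigma> \<delta> c G"
    "rscale \<sigma> \<delta> (c + d) F = rscale \<sigma> \<delta> c F + rscale \<sigma> \<delta> d F"
    "rscale \<sigma> \<delta> 1 F = F"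
    by (simp_all add: rscale_def mult_distrib const_add mult_one)
qed (simp_all add: one_sided_def vec_eq_iff left_eval_eq left_val_add left_val_rscale)

end

section \<open>P-independence and interpolation\<close>

lemma vanishing_ideals_strict_iff_separated:
  fixes a :: "'k::finite \<Rightarrow> 'a::zero ^ 'n" and ev :: "('n, 'a) skew_poly \<Rightarrow> 'a ^ 'n \<Rightarrow> 'a"
  assumes "inj a"
  shows "(finite (range a) \<and>
      (\<forall>p\<in>range a. vanishing_ideal ev (range a) \<subset> vanishing_ideal ev (range a - {p}))) \<longleftrightarrow>
    (\<forall>j. \<exists>F. ev F (a j) \<noteq> 0 \<and> (\<forall>i. i \<noteq> j \<longrightarrow> ev F (a i) = 0))"
proof -
  have "vanishing_ideal ev (range a) \<subset> vanishing_ideal ev (range a - {a j}) \<longleftrightarrow>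
      (\<exists>F. ev F (a j) \<noteq> 0 \<and> (\<forall>i. i \<noteq> j \<longrightarrow> ev F (a i) = 0))" for j
  proof -
    have without: "F \<in> vanishing_ideal ev (range a - {a j}) \<longleftrightarrow> (\<forall>i. i \<noteq> j \<longrightarrow> ev F (a i) = 0)" for F
      unfolding vanishing_ideal_def using inj_eq[OF assms] by auto
    have all: "F \<in> vanishing_ideal ev (range a) \<longleftrightarrow>
        ev F (a j) = 0 \<and> F \<in> vanishing_ideal ev (range a - {a j})" for F
      unfolding without by (auto simp: vanishing_ideal_def)
    have "vanishing_ideal ev (range a) \<subset> vanishing_ideal ev (range a - {a j}) \<longleftrightarrow>
        (\<exists>F. F \<in> vanishing_ideal ev (range a - {a j}) \<and> F \<notin> vanishing_ideal ev (range a))"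
      using all by blast
    then show ?thesis unfolding all unfolding without by blast
  qed
  then show ?thesis by simp
qed

theorem corollary3p16:
  fixes \<sigma> :: "'a::division_ring \<Rightarrow> 'a ^ 'n::finite ^ 'n"
    and \<delta> :: "'a \<Rightarrow> 'a ^ 'n"
    and a :: "'k::finite \<Rightarrow> 'a ^ 'n"
  assumes "matrix_ring_hom \<sigma>"
    and "vector_derivation \<sigma> \<delta>"
    and "inj a"
  shows
    "((left_P_independent \<sigma> \<delta> (range a) \<longleftrightarrow>
        (\<exists>F :: 'k \<Rightarrow> ('n, 'a) skew_poly.
           (\<forall>i. skew_degree (F i) < ereal (real CARD('k))) \<and>
           module_isomorphism_on lscale (*s) (submodule lscale hull range F) (UNIV :: ('a ^ 'k) set)
             (\<lambda>G. \<chi> j. right_eval \<sigma> \<delta> G (a j)))) \<and>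
      (left_P_independent \<sigma> \<delta> (range a) \<longleftrightarrow>
        (\<forall>b :: 'k \<Rightarrow> 'a. \<exists>F :: ('n, 'a) skew_poly.
           skew_degree F < ereal (real CARD('k)) \<and> (\<forall>j. right_eval \<sigma> \<delta> F (a j) = b j))))
     \<and>
     (additive_group_iso (phi_map \<sigma>) \<longrightarrow>
      (right_P_independent \<sigma> \<delta> (range a) \<longleftrightarrow>
        (\<exists>F :: 'k \<Rightarrow> ('n, 'a) skew_poly.
           (\<forall>i. skew_degree (F i) < ereal (real CARD('k))) \<and>
           module_isomorphism_on (rscale \<sigma> \<delta>) vec_rscale (submodule (rscale \<sigma> \<delta>) hull range F)
             (UNIV :: ('a ^ 'k) set) (\<lambda>G. \<chi> j. left_eval \<sigma> \<delta> G (a j)))) \<and>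
      (right_P_independent \<sigma> \<delta> (range a) \<longleftrightarrow>
        (\<forall>b :: 'k \<Rightarrow> 'a. \<exists>F :: ('n, 'a) skew_poly.
           skew_degree F < ereal (real CARD('k)) \<and> (\<forall>j. left_eval \<sigma> \<delta> F (a j) = b j))))"
proof -
  have vec: "(\<forall>b :: 'k \<Rightarrow> 'a. \<exists>F. F \<in> D \<and> (\<forall>j. f F j = b j)) \<longleftrightarrow> (\<forall>v. \<exists>F\<in>D. (\<chi> j. f F j) = v)"
    for D :: "('n, 'a) skew_poly set" and f
  proof (intro iffI allI)
    fix v :: "'a ^ 'k"
    assume "\<forall>b :: 'k \<Rightarrow> 'a. \<exists>F. F \<in> D \<and> (\<forall>j. f F j = b j)"
    then obtain F where "F \<in> D" "\<And>j. f F j = v $ j" by blast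
    then show "\<exists>F\<in>D. (\<chi> j. f F j) = v" by (intro bexI[of _ F]) (simp_all add: vec_eq_iff)
  next
    fix b :: "'k \<Rightarrow> 'a"
    assume "\<forall>v. \<exists>F\<in>D. (\<chi> j. f F j) = v"
    then obtain F where "F \<in> D" "(\<chi> j. f F j) = (\<chi> j. b j)" by blast
    then show "\<exists>F. F \<in> D \<and> (\<forall>j. f F j = b j)" by (intro exI[of _ F]) (simp add: vec_eq_iff)
  qed
  have left_act: "(*s) = coordwise (\<lambda>c x :: 'a. c * x)"
    by (intro ext) (simp add: vec_eq_iff)
  have right_act: "vec_rscale = coordwise (\<lambda>c x :: 'a. x * c)"
    by (intro ext) (simp add: vec_eq_iff vec_rscale_def)
  interpret skew_ring \<sigma> \<delta>
    using assms by unfold_locales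
  interpret R: filtered_evaluation "\<lambda>c x. c * x" lscale
    "\<lambda>F. \<chi> j. right_eval \<sigma> \<delta> F (a j)" degree_below
    by (rule right_eval_filtered)
  have left: "left_P_independent \<sigma> \<delta> (range a) \<longleftrightarrow>
      (\<forall>v. \<exists>F\<in>degree_below CARD('k). (\<chi> j. right_eval \<sigma> \<delta> F (a j)) = v)"
    using R.separated_iff_interpolation
    unfolding left_P_independent_def vanishing_ideals_strict_iff_separated[OF assms(3)] by simp
  have right: "right_P_independent \<sigma> \<delta> (range a) \<longleftrightarrow>
        (\<forall>v. \<exists>F\<in>degree_below CARD('k). (\<chi> j. left_eval \<sigma> \<delta> F (a j)) = v)"
      "(\<forall>v. \<exists>F\<in>degree_below CARD('k). (\<chi> j. left_eval \<sigma> \<delta> F (a j)) = v) \<longleftrightarrow>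
       (\<exists>F :: 'k \<Rightarrow> ('n, 'a) skew_poly. (\<forall>i. F i \<in> degree_below CARD('k)) \<and>
          module_isomorphism_on (rscale \<sigma> \<delta>) vec_rscale (submodule (rscale \<sigma> \<delta>) hull range F)
            (UNIV :: ('a ^ 'k) set) (\<lambda>G. \<chi> j. left_eval \<sigma> \<delta> G (a j)))"
    if "additive_group_iso (phi_map \<sigma>)"
  proof -
    interpret invertible_skew_ring \<sigma> \<delta>
      using that by unfold_locales
    interpret L: filtered_evaluation "\<lambda>c x. x * c" "rscale \<sigma> \<delta>"
      "\<lambda>F. \<chi> j. left_eval \<sigma> \<delta> F (a j)" degree_below
      by (rule left_eval_filtered)
    show "right_P_independent \<sigma> \<delta> (range a) \<longleftrightarrow>
        (\<forall>v. \<exists>F\<in>degree_below CARD('k). (\<chi> j. left_eval \<sigma> \<delta> F (a j)) = v)"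
      using L.separated_iff_interpolation
      unfolding right_P_independent_def vanishing_ideals_strict_iff_separated[OF assms(3)] by simp
    show "(\<forall>v. \<exists>F\<in>degree_below CARD('k). (\<chi> j. left_eval \<sigma> \<delta> F (a j)) = v) \<longleftrightarrow>
       (\<exists>F :: 'k \<Rightarrow> ('n, 'a) skew_poly. (\<forall>i. F i \<in> degree_below CARD('k)) \<and>
          module_isomorphism_on (rscale \<sigma> \<delta>) vec_rscale (submodule (rscale \<sigma> \<delta>) hull range F)
            (UNIV :: ('a ^ 'k) set) (\<lambda>G. \<chi> j. left_eval \<sigma> \<delta> G (a j)))"
      unfolding right_act by (rule L.interpolation_iff_isomorphism)
  qed
  show ?thesis
    unfolding skew_degree_less_card_iff vec
  proof (intro conjI impI)
    show "left_P_independent \<sigma> \<delta> (range a) \<longleftrightarrow>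
        (\<exists>F :: 'k \<Rightarrow> ('n, 'a) skew_poly. (\<forall>i. F i \<in> degree_below CARD('k)) \<and>
           module_isomorphism_on lscale (*s) (submodule lscale hull range F) (UNIV :: ('a ^ 'k) set)
             (\<lambda>G. \<chi> j. right_eval \<sigma> \<delta> G (a j)))"
      unfolding left left_act by (rule R.interpolation_iff_isomorphism)
  qed (rule left | (rule trans[OF right]; assumption) | (rule right(1), assumption))+
qed

end
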